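(* Let $b,c$ be integers with $b\leq 0$ and $c\leq\left\lfloor\frac{b^2}{4}\right\rfloor$, and let $\lambda$ be the largest root of the polynomial $x^2+bx+c$. Then there exists a graph $G$ whose spectral radius $\lambda_1(G)$ equals $\lambda$.
   Context: All graphs are finite simple graphs. The spectral radius $\lambda_1(G)$ of a graph $G$ is the largest eigenvalue of its adjacency matrix. *)

theory Defs
  imports
    "Graph_Theory.Pair_Digraph"
    "Jordan_Normal_Form.Spectral_Radius"
begin

text \<open>
  A finite simple graph is a \<^locale>\<open>pair_graph\<close>: finitely many vertices, and a symmetric
  loop-free set of ordered pairs of vertices, the two orientations \<open>(u, v)\<close> and \<open>(v, u)\<close>
  standing for the one undirected edge \<open>uv\<close>.  Rows and columns of the adjacency matrix are
  indexed by the vertices in increasing order; another enumeration would conjugate the matrix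
  by a permutation matrix, which does not change its eigenvalues.
\<close>

definition adjacency_matrix :: "('a :: linorder) pair_pre_digraph \<Rightarrow> real mat" where
  "adjacency_matrix G =
     (let vs = sorted_list_of_set (pverts G); n = card (pverts G)
      in mat n n (\<lambda>(i, j). if (vs ! i, vs ! j) \<in> parcs G then 1 else 0))"

text \<open>
  The adjacency matrix is real symmetric, so all its eigenvalues are real, and there is at
  least one of them as soon as the graph has a vertex.  For the graph without vertices the
  maximum is taken over the empty set and has no meaning.
\<close>

definition graph_spectral_radius :: "('a :: linorder) pair_pre_digraph \<Rightarrow> real" where
  "graph_spectral_radius G = Max (spectrum (adjacency_matrix G))"

end

theory Submission
  imports Defs
begin

text \<open>
  A nonnegative matrix with a strictly positive eigenvector has the corresponding eigenvalue as
  its largest one. Write \<open>-b = p + s\<close> with \<open>p = \<lceil>-b/2\<rceil>\<close> and \<open>s = \<lfloor>-b/2\<rfloor>\<close>, so that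
  \<open>p s = \<lfloor>b\<^sup>2/4\<rfloor>\<close> and \<open>k = p s - c\<close> is a natural number. Take \<open>s + 1\<close> disjoint copies of \<open>K\<^sub>p\<^sub>+\<^sub>1\<close>,
  join each of their vertices to \<open>k\<close> new vertices, and arrange the new vertices in
  disjoint copies of \<open>K\<^sub>s\<^sub>+\<^sub>1\<close>. The partition into old and new vertices is equitable with quotient
  matrix \<open>[[p, k], [1, s]]\<close>, whose characteristic polynomial is \<open>x\<^sup>2 + b x + c\<close>, and its Perron
  vector \<open>(\<lambda> - s, 1)\<close> lifts to a positive eigenvector of the graph.
\<close>

text \<open>Any eigenvector \<open>x\<close> is compared with \<open>f\<close> at an index
  \<open>i\<close> where \<open>\<bar>x $ i\<bar> / f $ i\<close> is maximal. There the triangle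
  inequality in row \<open>i\<close> of \<open>A *\<^sub>v x\<close> bounds the eigenvalue of
  \<open>x\<close> by \<open>lam\<close>.\<close>

lemma Max_spectrum_eq_positive_eigenvector:
  fixes A :: "real mat" and f :: "real vec"
  assumes A: "A \<in> carrier_mat n n" and n: "n > 0"
    and nonneg: "\<And>i j. i < n \<Longrightarrow> j < n \<Longrightarrow> A $$ (i, j) \<ge> 0"
    and f: "f \<in> carrier_vec n" and pos: "\<And>i. i < n \<Longrightarrow> f $ i > 0"
    and ev: "A *\<^sub>v f = lam \<cdot>\<^sub>v f"
  shows "Max (spectrum A) = lam"
proof (rule Max_eqI)
  show "finite (spectrum A)"
    using card_finite_spectrum[OF A] by simp
  have "f \<noteq> 0\<^sub>v n"
    using pos[OF n] n by auto
  then have "eigenvector A f lam"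
    using A f ev by (simp add: eigenvector_def)
  then show "lam \<in> spectrum A"
    by (auto simp: spectrum_def eigenvalue_def)
next
  fix mu
  assume "mu \<in> spectrum A"
  then obtain x where x: "x \<in> carrier_vec n" "x \<noteq> 0\<^sub>v n" "A *\<^sub>v x = mu \<cdot>\<^sub>v x"
    using A by (auto simp: spectrum_def eigenvalue_def eigenvector_def)
  have mult: "(A *\<^sub>v y) $ i = (\<Sum>j<n. A $$ (i, j) * y $ j)"
    if "y \<in> carrier_vec n" "i < n" for y i
    using that A by (simp add: scalar_prod_def lessThan_atLeast0)
  \<comment> \<open>The least \<open>m\<close> with \<open>\<bar>x\<bar> \<le> m * f\<close>
    entrywise; equality holds at the maximising index \<open>i\<close>.\<close>
  define m where "m = Max ((\<lambda>i. \<bar>x $ i\<bar> / f $ i) ` {..<n})"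
  have "m \<in> (\<lambda>i. \<bar>x $ i\<bar> / f $ i) ` {..<n}"
    unfolding m_def using n by (intro Max_in) auto
  then obtain i where i: "i < n" "m = \<bar>x $ i\<bar> / f $ i"
    by auto
  have bound: "\<bar>x $ j\<bar> \<le> m * f $ j" if "j < n" for j
  proof -
    have "\<bar>x $ j\<bar> / f $ j \<le> m"
      unfolding m_def using that by (intro Max_ge) auto
    then show ?thesis
      using pos[OF that] by (simp add: field_simps)
  qed
  have m_eq: "m * f $ i = \<bar>x $ i\<bar>"
    using i pos[of i] by simp
  obtain j where j: "j < n" "x $ j \<noteq> 0"
    using x by (metis carrier_vecD eq_vecI index_zero_vec(1) index_zero_vec(2))
  have "0 < m * f $ j"
    using bound[OF j(1)] j(2) by linarith
  then have "m > 0"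
    using pos[OF j(1)] by (simp add: zero_less_mult_iff)
  \<comment> \<open>Strictness allows \<open>\<bar>x $ i\<bar>\<close> to be cancelled from the
    final inequality.\<close>
  then have xi: "\<bar>x $ i\<bar> > 0"
    using m_eq pos[OF i(1)] by (metis mult_pos_pos)
  have "\<bar>mu\<bar> * \<bar>x $ i\<bar> = \<bar>(A *\<^sub>v x) $ i\<bar>"
    using x i by (simp add: abs_mult)
  also have "\<dots> \<le> (\<Sum>j<n. \<bar>A $$ (i, j) * x $ j\<bar>)"
    unfolding mult[OF x(1) i(1)] by (rule sum_abs)
  also have "\<dots> \<le> (\<Sum>j<n. A $$ (i, j) * (m * f $ j))"
    using nonneg[OF i(1)] bound by (intro sum_mono) (auto simp: abs_mult intro: mult_left_mono)
  also have "\<dots> = m * (A *\<^sub>v f) $ i"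
    unfolding mult[OF f i(1)] by (simp add: sum_distrib_left algebra_simps)
  also have "\<dots> = lam * \<bar>x $ i\<bar>"
    using f i(1) m_eq[symmetric] by (simp add: ev)
  finally show "mu \<le> lam"
    using xi by simp
qed

text \<open>Row \<open>i\<close> of the matrix equation is a sum over the neighbours of vertex
  \<open>i\<close>, so the sorted enumeration of the vertices drops out.\<close>

lemma graph_spectral_radius_eqI:
  fixes G :: "('a :: linorder) pair_pre_digraph" and f :: "'a \<Rightarrow> real"
  assumes fin: "finite (pverts G)" and ne: "pverts G \<noteq> {}"
    and pos: "\<And>v. v \<in> pverts G \<Longrightarrow> f v > 0"
    and ev: "\<And>v. v \<in> pverts G \<Longrightarrow> (\<Sum>u | u \<in> pverts G \<and> (v, u) \<in> parcs G. f u) = lam * f v"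
  shows "graph_spectral_radius G = lam"
proof -
  define vs where "vs = sorted_list_of_set (pverts G)"
  define n where "n = card (pverts G)"
  have vs: "distinct vs" "set vs = pverts G" "length vs = n"
    using fin by (auto simp: vs_def n_def)
  have adj: "adjacency_matrix G = mat n n (\<lambda>(i, j). if (vs ! i, vs ! j) \<in> parcs G then 1 else 0)"
    by (simp add: adjacency_matrix_def vs_def n_def Let_def)
  have bij: "bij_betw ((!) vs) {..<n} (pverts G)"
    using vs by (intro bij_betw_nth) auto
  have vs_in: "vs ! i \<in> pverts G" if "i < n" for i
    using that vs by (metis nth_mem)
  show ?thesis
    unfolding graph_spectral_radius_def
  proof (rule Max_spectrum_eq_positive_eigenvector[where n = n and f = "vec n (\<lambda>i. f (vs ! i))"])
    show "n > 0"
      using fin ne by (simp add: n_def card_gt_0_iff)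
    show "adjacency_matrix G *\<^sub>v vec n (\<lambda>i. f (vs ! i)) = lam \<cdot>\<^sub>v vec n (\<lambda>i. f (vs ! i))"
    proof (rule eq_vecI)
      fix i
      assume "i < dim_vec (lam \<cdot>\<^sub>v vec n (\<lambda>i. f (vs ! i)))"
      then have i: "i < n"
        by simp
      then have "(adjacency_matrix G *\<^sub>v vec n (\<lambda>i. f (vs ! i))) $ i =
          (\<Sum>j<n. (if (vs ! i, vs ! j) \<in> parcs G then 1 else 0) * f (vs ! j))"
        by (simp add: adj scalar_prod_def lessThan_atLeast0)
      also have "\<dots> = (\<Sum>u\<in>pverts G. (if (vs ! i, u) \<in> parcs G then 1 else 0) * f u)"
        by (rule sum.reindex_bij_betw[OF bij])
      also have "\<dots> = (\<Sum>u | u \<in> pverts G \<and> (vs ! i, u) \<in> parcs G. f u)"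
        using fin by (intro sum.mono_neutral_cong_right) auto
      also have "\<dots> = lam * f (vs ! i)"
        using vs_in[OF i] by (rule ev)
      finally show "(adjacency_matrix G *\<^sub>v vec n (\<lambda>i. f (vs ! i))) $ i =
          (lam \<cdot>\<^sub>v vec n (\<lambda>i. f (vs ! i))) $ i"
        using i by simp
    qed (simp add: adj)
  qed (use pos vs_in in \<open>auto simp: adj\<close>)
qed

text \<open>Relabelling by the injection \<open>to_nat\<close> keeps neighbourhood sums, so a graph
  may be built on any convenient countable type, such as triples.\<close>

lemma exists_nat_graph_spectral_radius:
  fixes V :: "('a :: countable) set" and R :: "'a \<Rightarrow> 'a \<Rightarrow> bool" and f :: "'a \<Rightarrow> real"
  assumes fin: "finite V" and ne: "V \<noteq> {}"
    and irrefl: "\<And>v. \<not> R v v" and sym: "\<And>u v. R u v \<Longrightarrow> R v u"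
    and pos: "\<And>v. v \<in> V \<Longrightarrow> f v > 0"
    and ev: "\<And>v. v \<in> V \<Longrightarrow> (\<Sum>u | u \<in> V \<and> R v u. f u) = lam * f v"
  shows "\<exists>G :: nat pair_pre_digraph.
           pair_graph G \<and> pverts G \<noteq> {} \<and> graph_spectral_radius G = lam"
proof -
  define G :: "nat pair_pre_digraph" where
    "G = \<lparr>pverts = to_nat ` V, parcs = {(to_nat u, to_nat v) | u v. u \<in> V \<and> v \<in> V \<and> R u v}\<rparr>"
  have verts: "pverts G = to_nat ` V"
    by (simp add: G_def)
  have arcs: "(to_nat u, to_nat v) \<in> parcs G \<longleftrightarrow> u \<in> V \<and> v \<in> V \<and> R u v" for u v :: 'a
    by (auto simp: G_def)
  have sub: "parcs G \<subseteq> pverts G \<times> pverts G"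
    by (auto simp: G_def)
  have "pair_graph G"
  proof
    show "finite (pverts G)" "finite (parcs G)"
      using fin finite_subset[OF sub] by (auto simp: verts)
    show "symmetric G"
      by (auto simp: symmetric_def G_def arcs_ends_def arc_to_ends_def intro!: symI dest: sym)
  qed (use sub irrefl in \<open>auto simp: G_def\<close>)
  moreover have "graph_spectral_radius G = lam"
  proof (rule graph_spectral_radius_eqI[where f = "f \<circ> from_nat"])
    fix v
    assume "v \<in> pverts G"
    then obtain w where w: "w \<in> V" "v = to_nat w"
      by (auto simp: verts)
    have "{u. u \<in> pverts G \<and> (v, u) \<in> parcs G} = to_nat ` {u. u \<in> V \<and> R w u}"
      using w by (auto simp: verts arcs)
    then have "(\<Sum>u | u \<in> pverts G \<and> (v, u) \<in> parcs G. (f \<circ> from_nat) u) =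
        (\<Sum>u | u \<in> V \<and> R w u. f u)"
      by (simp add: sum.reindex inj_on_def)
    then show "(\<Sum>u | u \<in> pverts G \<and> (v, u) \<in> parcs G. (f \<circ> from_nat) u) =
        lam * (f \<circ> from_nat) v"
      using ev w by simp
  qed (use fin ne pos in \<open>auto simp: verts\<close>)
  ultimately show ?thesis
    using ne verts by blast
qed

text \<open>\<open>root\<close> is the characteristic equation of the quotient matrix;
  \<open>half\<close> selects its larger root, which ensures \<open>lam \<ge> s\<close>.\<close>

lemma exists_graph_spectral_radius_quotient:
  fixes p s k :: nat and lam :: real
  assumes root: "(lam - p) * (lam - s) = k" and "s \<le> p" and half: "p + s \<le> 2 * lam"
  shows "\<exists>G :: nat pair_pre_digraph.
           pair_graph G \<and> pverts G \<noteq> {} \<and> graph_spectral_radius G = lam"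
proof -
  \<comment> \<open>\<open>j\<close> numbers the \<open>s + 1\<close> copies of the clique on
    \<open>p + 1\<close> vertices and \<open>i\<close> the position within a copy. For fixed
    \<open>i\<close> and \<open>t > 0\<close>, varying \<open>j\<close> gives a clique of new
    vertices.\<close>
  define V where "V = {..p} \<times> {..s} \<times> {..k}"
  \<comment> \<open>Old vertices have third coordinate \<open>0\<close>; the vertices \<open>(i, j, t)\<close> with \<open>t > 0\<close> are the new
    neighbours of \<open>(i, j, 0)\<close>.\<close>
  define R :: "nat \<times> nat \<times> nat \<Rightarrow> nat \<times> nat \<times> nat \<Rightarrow> bool" where
    "R = (\<lambda>(i, j, t) (i', j', t').
        t = 0 \<and> t' = 0 \<and> j = j' \<and> i \<noteq> i' \<or>
        t > 0 \<and> t = t' \<and> i = i' \<and> j \<noteq> j' \<or>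
        i = i' \<and> j = j' \<and> (t = 0 \<longleftrightarrow> t' > 0))"
  \<comment> \<open>For \<open>k = 0\<close> there are no new vertices, and \<open>lam - s\<close> may vanish.\<close>
  define x where "x = (if k = 0 then 1 else lam - s)"
  define f :: "nat \<times> nat \<times> nat \<Rightarrow> real" where "f = (\<lambda>(i, j, t). if t = 0 then x else 1)"
  have lam_s: "lam \<ge> s"
    using \<open>s \<le> p\<close> half by linarith
  \<comment> \<open>For \<open>k > 0\<close> the product in \<open>root\<close> is nonzero, hence
    \<open>lam \<noteq> s\<close>.\<close>
  have x_pos: "x > 0"
    using root lam_s by (cases "lam = s") (auto simp: x_def)
  \<comment> \<open>The eigenvalue equation at an old vertex: \<open>p\<close> neighbours of weight
    \<open>x\<close> and \<open>k\<close> of weight 1.\<close>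
  have old: "p * x + k = lam * x"
  proof (cases "k = 0")
    case True
    \<comment> \<open>The other root \<open>lam = s\<close> would give \<open>p \<le> s\<close> by
      \<open>half\<close>, hence \<open>p = s\<close>.\<close>
    then have "lam = p"
      using root \<open>s \<le> p\<close> half by auto
    then show ?thesis
      using True by (simp add: x_def)
  next
    case False
    then show ?thesis
      using root by (simp add: x_def algebra_simps)
  qed
  have ev_old: "(\<Sum>u | u \<in> V \<and> R (i, j, 0) u. f u) = lam * x" if "i \<le> p" "j \<le> s" for i j
  proof -
    have "{u. u \<in> V \<and> R (i, j, 0) u} =
        (\<lambda>i'. (i', j, 0)) ` ({..p} - {i}) \<union> (\<lambda>t. (i, j, t)) ` {1..k}"
      using that by (auto simp: V_def R_def)
    also have "sum f \<dots> = sum f ((\<lambda>i'. (i', j, 0)) ` ({..p} - {i})) + sum f ((\<lambda>t. (i, j, t)) ` {1..k})"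
      by (intro sum.union_disjoint) auto
    also have "\<dots> = p * x + k"
      using that by (simp add: sum.reindex inj_on_def f_def)
    finally show ?thesis
      using old by simp
  qed
  have ev_new: "(\<Sum>u | u \<in> V \<and> R (i, j, t) u. f u) = lam"
    if "i \<le> p" "j \<le> s" "t \<le> k" "t > 0" for i j t
  proof -
    have "{u. u \<in> V \<and> R (i, j, t) u} = insert (i, j, 0) ((\<lambda>j'. (i, j', t)) ` ({..s} - {j}))"
      using that by (auto simp: V_def R_def)
    also have "sum f \<dots> = x + s"
      using that by (subst sum.insert) (auto simp: sum.reindex inj_on_def f_def)
    finally show ?thesis
      \<comment> \<open>Since \<open>0 < t \<le> k\<close>, the exceptional case
        \<open>k = 0\<close> is excluded and \<open>x = lam - s\<close>.\<close>
      using that by (simp add: x_def)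
  qed
  show ?thesis
  proof (rule exists_nat_graph_spectral_radius[where V = V and R = R and f = f])
    show "(\<Sum>u | u \<in> V \<and> R v u. f u) = lam * f v" if "v \<in> V" for v
    proof -
      obtain i j t where v: "v = (i, j, t)" "i \<le> p" "j \<le> s" "t \<le> k"
        using \<open>v \<in> V\<close> by (auto simp: V_def)
      show ?thesis
        using ev_old[of i j] ev_new[of i j t] v by (cases "t = 0") (auto simp: f_def)
    qed
  qed (use x_pos in \<open>auto simp: V_def R_def f_def\<close>)
qed

theorem theorem4p4:
  fixes b c :: int and lam :: real
  assumes "b \<le> 0"
    and "c \<le> \<lfloor>(real_of_int b)\<^sup>2 / 4\<rfloor>"
    and "lam = Max {x :: real. poly [:real_of_int c, real_of_int b, 1:] x = 0}"
  shows "\<exists>G :: nat pair_pre_digraph.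
           pair_graph G \<and> pverts G \<noteq> {} \<and> graph_spectral_radius G = lam"
proof -
  define S where "S = {x :: real. poly [:real_of_int c, real_of_int b, 1:] x = 0}"
  have S_iff: "x \<in> S \<longleftrightarrow> x\<^sup>2 + b * x + c = 0" for x :: real
    by (simp add: S_def power2_eq_square algebra_simps)
  have "finite S"
    unfolding S_def by (rule poly_roots_finite) simp
  have "real_of_int c \<le> (real_of_int b)\<^sup>2 / 4"
    using assms(2) by (simp add: le_floor_iff)
  then have disc_real: "4 * real_of_int c \<le> (real_of_int b)\<^sup>2"
    by simp
  then have disc: "4 * c \<le> b\<^sup>2"
    by (metis of_int_le_iff of_int_mult of_int_numeral of_int_power)
  \<comment> \<open>A root given by the quadratic formula shows that \<open>S\<close> is nonempty,
    so its \<open>Max\<close> is meaningful.\<close>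
  define d where "d = sqrt ((real_of_int b)\<^sup>2 - 4 * c)"
  have "d\<^sup>2 = (real_of_int b)\<^sup>2 - 4 * c"
    using disc_real by (simp add: d_def)
  then have "(d - b) / 2 \<in> S"
    by (simp add: S_iff power2_eq_square field_simps)
  then have lam_S: "lam \<in> S"
    using Max_in[OF \<open>finite S\<close>] assms(3)[folded S_def] by blast
  \<comment> \<open>The roots sum to \<open>- b\<close>, so the largest is at least their mean
    \<open>- b / 2\<close>.\<close>
  then have "- b - lam \<in> S"
    by (simp add: S_iff power2_eq_square algebra_simps)
  then have half: "- b \<le> 2 * lam"
    using Max_ge[OF \<open>finite S\<close>] assms(3)[folded S_def] by fastforce
  define s p where "s = nat (- b div 2)" and "p = nat (- b - - b div 2)"
  have ps: "int s = - b div 2" "int p = - b - int s" "s \<le> p"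
    using \<open>b \<le> 0\<close> by (auto simp: s_def p_def)
  have "c \<le> int p * int s"
  proof (cases "even b")
    case True
    then have b: "b = - (2 * int s)"
      using ps by auto
    then have "int p = int s"
      using ps(2) by linarith
    then show ?thesis
      using disc by (simp add: b power2_eq_square)
  next
    case False
    then have b: "b = - (2 * int s + 1)"
      using ps by presburger
    then have "int p = int s + 1"
      using ps(2) by linarith
    \<comment> \<open>Here \<open>b\<^sup>2 = 4 * p * s + 1\<close>; the surplus 1 disappears
      because \<open>c\<close> is an integer.\<close>
    then have "4 * c \<le> 4 * (int p * int s) + 1"
      using disc by (simp add: b power2_eq_square algebra_simps)
    then show ?thesis
      by linarith
  qed
  then obtain k where "int p * int s - c = int k"
    by (metis diff_ge_0_iff_ge nonneg_int_cases)
  then have "real_of_int (int p * int s - c) = real k"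
    by simp
  then have k: "real k = real p * real s - c"
    by simp
  have b: "real_of_int b = - (real p + real s)"
    using ps(2) by linarith
  have "(lam - p) * (lam - s) = k" "p + s \<le> 2 * lam"
    using lam_S half by (auto simp: S_iff b k power2_eq_square algebra_simps)
  then show ?thesis
    using \<open>s \<le> p\<close> by (intro exists_graph_spectral_radius_quotient)
qed

end
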